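(* Let $m,n\in\mathbb{N}$ satisfy $m\le n$ and let $G=K_{m,n}$. (i) $G$ is $(3,2)$-choosable if and only if one of the following holds: $m=1$ and $n\in\mathbb{N}$; $m=2$ and $n\le 8$; $m=3$ and $n\le 6$; or $m=4$ and $n=4$. (ii) $G$ is $(2,3)$-choosable if and only if one of the following holds: $m\in\{1,2\}$ and $n\in\mathbb{N}$; $m=3$ and $n\le 7$; or $m=4$ and $n\le 5$.
   Context: $\mathbb{N}=\{1,2,3,\ldots\}$. $K_{m,n}$ is the complete bipartite graph with partite sets $A$ of size $m$ and $B$ of size $n$. A list assignment $L$ for a graph assigns to each vertex $v$ a set $L(v)$ of colors; a proper $L$-coloring is a proper coloring $f$ with $f(v)\in L(v)$ for every vertex $v$. An $(a,b)$-assignment for $K_{m,n}$ is a list assignment $L$ with $|L(v)|=a$ for every $v\in A$ (the partite set of size $m$, the first index) and $|L(v)|=b$ for every $v\in B$ (the partite set of size $n$, the second index). $K_{m,n}$ is $(a,b)$-choosable if it has a proper $L$-coloring for every $(a,b)$-assignment $L$. *)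

theory Defs
  imports Main "Graph_Theory.Graph_Theory"
begin

text \<open>
  An undirected simple graph is the locale \<open>graph\<close> of \<open>Graph_Theory\<close>: a finite, symmetric,
  loop-free digraph without parallel arcs. The library's \<open>complete_bipartite_digraph\<close>
  hides the two partite sets behind an existential quantifier, but \<open>(a,b)\<close>-assignments
  distinguish them, so here they are explicit.
\<close>

definition complete_bipartite_on ::
    "('v, 'e) pre_digraph \<Rightarrow> 'v set \<Rightarrow> 'v set \<Rightarrow> bool" where
  "complete_bipartite_on G A B \<longleftrightarrow>
     graph G \<and> verts G = A \<union> B \<and> A \<inter> B = {} \<and> arcs_ends G = A \<times> B \<union> B \<times> A"

lemma complete_bipartite_digraph_iff:
  "complete_bipartite_digraph m n G \<longleftrightarrow>
     (\<exists>A B. complete_bipartite_on G A B \<and> card A = m \<and> card B = n)"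
  unfolding complete_bipartite_digraph_def complete_bipartite_on_def by blast

definition proper_list_coloring ::
    "('v, 'e) pre_digraph \<Rightarrow> ('v \<Rightarrow> 'c set) \<Rightarrow> ('v \<Rightarrow> 'c) \<Rightarrow> bool" where
  "proper_list_coloring G L f \<longleftrightarrow>
     (\<forall>v\<in>verts G. f v \<in> L v) \<and> (\<forall>u v. (u, v) \<in> arcs_ends G \<longrightarrow> f u \<noteq> f v)"

definition ab_assignment ::
    "'v set \<Rightarrow> 'v set \<Rightarrow> nat \<Rightarrow> nat \<Rightarrow> ('v \<Rightarrow> 'c set) \<Rightarrow> bool" where
  "ab_assignment A B a b L \<longleftrightarrow>
     (\<forall>v\<in>A. finite (L v) \<and> card (L v) = a) \<and> (\<forall>v\<in>B. finite (L v) \<and> card (L v) = b)"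

text \<open>
  Colors are natural numbers. Since the graph and all lists are finite, this loses nothing:
  see \<open>ab_choosable_any_color_type\<close>.
\<close>

definition ab_choosable ::
    "('v, 'e) pre_digraph \<Rightarrow> 'v set \<Rightarrow> 'v set \<Rightarrow> nat \<Rightarrow> nat \<Rightarrow> bool" where
  "ab_choosable G A B a b \<longleftrightarrow>
     (\<forall>L :: 'v \<Rightarrow> nat set. ab_assignment A B a b L \<longrightarrow> (\<exists>f. proper_list_coloring G L f))"

lemma ab_choosable_any_color_type:
  fixes L :: "'v \<Rightarrow> 'c set"
  assumes G: "complete_bipartite_on G A B"
    and ch: "ab_choosable G A B a b"
    and L: "ab_assignment A B a b L"
  shows "\<exists>f. proper_list_coloring G L f"
proof -
  let ?U = "\<Union>v\<in>A \<union> B. L v"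
  interpret graph G using G by (simp add: complete_bipartite_on_def)
  have V: "verts G = A \<union> B" using G by (simp add: complete_bipartite_on_def)
  have "finite (A \<union> B)" using finite_verts V by simp
  moreover have "finite (L v)" if "v \<in> A \<union> B" for v
    using L that unfolding ab_assignment_def by blast
  ultimately have "finite ?U" by (rule finite_UN_I)
  then have "\<exists>(h :: 'c \<Rightarrow> nat) n. h ` ?U = {i. i < n} \<and> inj_on h ?U"
    by (rule finite_imp_inj_to_nat_seg)
  then obtain h :: "'c \<Rightarrow> nat" where h: "inj_on h ?U" by blast
  have hL: "inj_on h (L v)" if "v \<in> A \<union> B" for v
    by (rule inj_on_subset[OF h]) (use that in blast)
  have "ab_assignment A B a b (\<lambda>v. h ` L v)"
    unfolding ab_assignment_def
  proof (intro conjI ballI)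
    fix v assume v: "v \<in> A"
    then have "finite (L v)" "card (L v) = a" using L unfolding ab_assignment_def by blast+
    then show "finite (h ` L v)" "card (h ` L v) = a"
      using v card_image[OF hL[of v]] by simp_all
  next
    fix v assume v: "v \<in> B"
    then have "finite (L v)" "card (L v) = b" using L unfolding ab_assignment_def by blast+
    then show "finite (h ` L v)" "card (h ` L v) = b"
      using v card_image[OF hL[of v]] by simp_all
  qed
  then obtain g where g: "proper_list_coloring G (\<lambda>v. h ` L v) g"
    using ch unfolding ab_choosable_def by blast
  then have "\<forall>v\<in>verts G. \<exists>c. c \<in> L v \<and> g v = h c"
    unfolding proper_list_coloring_def by blast
  then obtain f where f: "\<forall>v\<in>verts G. f v \<in> L v \<and> g v = h (f v)"
    using bchoice by metis
  have "f u \<noteq> f v" if uv: "(u, v) \<in> arcs_ends G" for u v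
  proof
    assume "f u = f v"
    moreover have "u \<in> verts G" "v \<in> verts G" using uv by (rule adj_in_verts)+
    ultimately have "g u = g v" using f by simp
    then show False using g uv unfolding proper_list_coloring_def by blast
  qed
  then show ?thesis using f unfolding proper_list_coloring_def by blast
qed

end

(* Let T be the set of colors used on A. A proper coloring exists iff some T meets every list of A
   and contains no list of B; passing to the complement of T swaps the two sides. If the lists of one
   side are pairwise disjoint, a random transversal works by a union bound as soon as the other side
   has few lists. If two of them share a color v, the sets T through v force so many lists on the
   other side that the remaining ones cannot block all T avoiding v. *)

theory Submission
  imports Defs "HOL-Library.FuncSet" "HOL-Library.Disjoint_Sets"
begin

section \<open>Separation of two set families by a set of colors\<close>

section \<open>Separating sets\<close>

definition separated :: "'c set set \<Rightarrow> 'c set set \<Rightarrow> bool" where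
  "separated \<A> \<B> \<longleftrightarrow> (\<exists>T. (\<forall>X\<in>\<A>. X \<inter> T \<noteq> {}) \<and> (\<forall>Y\<in>\<B>. \<not> Y \<subseteq> T))"

text \<open>The sizes are upper bounds because distinct vertices may carry the same list, so the
  family of lists can be smaller than the partite set. This also makes the notion monotone in
  \<open>m\<close> and \<open>n\<close>.\<close>

definition separable :: "nat \<Rightarrow> nat \<Rightarrow> nat \<Rightarrow> nat \<Rightarrow> bool" where
  "separable a m b n \<longleftrightarrow>
     (\<forall>\<A> \<B> :: nat set set. finite \<A> \<longrightarrow> finite \<B> \<longrightarrow> card \<A> \<le> m \<longrightarrow> card \<B> \<le> n \<longrightarrow>
        (\<forall>X\<in>\<A>. card X = a) \<longrightarrow> (\<forall>Y\<in>\<B>. card Y = b) \<longrightarrow> separated \<A> \<B>)"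

lemma separatedI:
  assumes "\<And>X. X \<in> \<A> \<Longrightarrow> X \<inter> T \<noteq> {}" and "\<And>Y. Y \<in> \<B> \<Longrightarrow> \<not> Y \<subseteq> T"
  shows "separated \<A> \<B>"
  using assms unfolding separated_def by blast

lemma not_separatedI:
  assumes "\<And>T. (\<forall>X\<in>\<A>. X \<inter> T \<noteq> {}) \<longrightarrow> (\<exists>Y\<in>\<B>. Y \<subseteq> T)"
  shows "\<not> separated \<A> \<B>"
  unfolding separated_def using assms by metis

text \<open>\<open>C\<close> is the complement of the separating set: the colors left for the second
  family. Exchanging the two gives \<open>separated_commute\<close>.\<close>

lemma separatedI_cover:
  assumes "\<And>Y. Y \<in> \<B> \<Longrightarrow> Y \<inter> C \<noteq> {}" and "\<And>X. X \<in> \<A> \<Longrightarrow> \<not> X \<subseteq> C"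
  shows "separated \<A> \<B>"
  using assms by (intro separatedI[of _ "- C"]) blast+

lemma separated_commute: "separated \<A> \<B> \<longleftrightarrow> separated \<B> \<A>"
proof -
  have "separated \<B> \<A>" if sep: "separated \<A> \<B>" for \<A> \<B> :: "'c set set"
  proof -
    obtain T where T: "\<And>X. X \<in> \<A> \<Longrightarrow> X \<inter> T \<noteq> {}" "\<And>Y. Y \<in> \<B> \<Longrightarrow> \<not> Y \<subseteq> T"
      using sep unfolding separated_def by metis
    then show ?thesis by (rule separatedI_cover)
  qed
  then show ?thesis by metis
qed

lemma separableD:
  fixes \<A> \<B> :: "nat set set"
  assumes "separable a m b n" and "finite \<A>" and "finite \<B>"
    and "card \<A> \<le> m" and "card \<B> \<le> n"
    and "\<forall>X\<in>\<A>. card X = a" and "\<forall>Y\<in>\<B>. card Y = b"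
  shows "separated \<A> \<B>"
  using assms unfolding separable_def by metis

lemma separable_commute: "separable a m b n \<longleftrightarrow> separable b n a m"
  unfolding separable_def using separated_commute by blast

lemma separable_mono:
  assumes "separable a m b n" and "m' \<le> m" and "n' \<le> n"
  shows "separable a m' b n'"
  using assms unfolding separable_def by (meson order_trans)

lemma not_separableI:
  fixes \<A> \<B> :: "nat set set"
  assumes "\<not> separated \<A> \<B>" and "finite \<A>" and "finite \<B>"
    and "card \<A> \<le> m" and "card \<B> \<le> n"
    and "\<forall>X\<in>\<A>. card X = a" and "\<forall>Y\<in>\<B>. card Y = b"
  shows "\<not> separable a m b n"
  using assms separableD by metis

section \<open>From list colorings to separated families\<close>

lemma exists_list_coloring_iff:
  assumes G: "complete_bipartite_on G A B"
  shows "(\<exists>f. proper_list_coloring G L f) \<longleftrightarrow> separated (L ` A) (L ` B)"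
proof
  assume "\<exists>f. proper_list_coloring G L f"
  then obtain f where f: "\<And>v. v \<in> A \<union> B \<Longrightarrow> f v \<in> L v"
    "\<And>u v. u \<in> A \<Longrightarrow> v \<in> B \<Longrightarrow> f u \<noteq> f v"
    using G unfolding proper_list_coloring_def complete_bipartite_on_def by auto
  show "separated (L ` A) (L ` B)"
  proof (rule separatedI)
    fix X assume "X \<in> L ` A"
    then obtain v where "v \<in> A" "X = L v" by blast
    then show "X \<inter> f ` A \<noteq> {}" using f(1)[of v] by auto
  next
    fix Y assume "Y \<in> L ` B"
    then obtain v where v: "v \<in> B" "Y = L v" by blast
    then have "f v \<in> Y" using f(1)[of v] by simp
    moreover have "f v \<notin> f ` A" using f(2)[OF _ v(1)] by fastforce
    ultimately show "\<not> Y \<subseteq> f ` A" by blast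
  qed
next
  assume "separated (L ` A) (L ` B)"
  \<comment> \<open>Vertices of \<open>A\<close> take colors inside \<open>T\<close> and vertices of
    \<open>B\<close> take colors outside it, so no edge is monochromatic.\<close>
  then obtain T where T: "\<And>v. v \<in> A \<Longrightarrow> \<exists>c. c \<in> L v \<and> c \<in> T"
    "\<And>v. v \<in> B \<Longrightarrow> \<exists>c. c \<in> L v \<and> c \<notin> T"
    unfolding separated_def by (auto simp: subset_iff) blast
  then obtain g h where gh: "\<And>v. v \<in> A \<Longrightarrow> g v \<in> L v \<and> g v \<in> T"
    "\<And>v. v \<in> B \<Longrightarrow> h v \<in> L v \<and> h v \<notin> T"
    by metis
  have "A \<inter> B = {}" using G by (simp add: complete_bipartite_on_def)
  then have "proper_list_coloring G L (\<lambda>v. if v \<in> A then g v else h v)"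
    using G gh unfolding proper_list_coloring_def complete_bipartite_on_def
    by (auto split: if_splits) (metis gh)+
  then show "\<exists>f. proper_list_coloring G L f" by blast
qed

lemma finite_parts:
  assumes "complete_bipartite_on G A B"
  shows "finite A" and "finite B"
proof -
  interpret graph G using assms by (simp add: complete_bipartite_on_def)
  have "verts G = A \<union> B" using assms by (simp add: complete_bipartite_on_def)
  then have "finite (A \<union> B)" using finite_verts by metis
  then show "finite A" "finite B" by auto
qed

lemma exists_map_onto:
  assumes "finite A" and "finite \<A>" and "\<A> \<noteq> {}" and "card \<A> \<le> card A"
  shows "\<exists>g. g ` A = \<A>"
proof -
  obtain h where h: "h ` \<A> \<subseteq> A" "inj_on h \<A>"
    using card_le_inj[OF assms(2,1,4)] by blast
  obtain Z where Z: "Z \<in> \<A>" using assms(3) by blast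
  \<comment> \<open>Vertices outside the image of \<open>h\<close> receive the default set
    \<open>Z\<close>; repeating a list does not change the family.\<close>
  let ?g = "\<lambda>v. if v \<in> h ` \<A> then the_inv_into \<A> h v else Z"
  have "?g ` A = \<A>"
  proof (intro equalityI subsetI)
    fix X assume "X \<in> ?g ` A"
    then show "X \<in> \<A>" using h(2) Z by (auto simp: the_inv_into_f_f)
  next
    fix X assume X: "X \<in> \<A>"
    then have "?g (h X) = X" "h X \<in> A" using h by (auto simp: the_inv_into_f_f)
    then show "X \<in> ?g ` A" by (rule image_eqI[OF sym])
  qed
  then show ?thesis by blast
qed

lemma ab_choosable_iff_separable:
  assumes G: "complete_bipartite_on G A B" and ne: "A \<noteq> {}" "B \<noteq> {}" and pos: "0 < a" "0 < b"
  shows "ab_choosable G A B a b \<longleftrightarrow> separable a (card A) b (card B)"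
proof
  note fin = finite_parts[OF G]
  assume ch: "ab_choosable G A B a b"
  show "separable a (card A) b (card B)"
    unfolding separable_def
  proof (intro allI impI)
    fix \<A> \<B> :: "nat set set"
    assume fin': "finite \<A>" "finite \<B>" and card: "card \<A> \<le> card A" "card \<B> \<le> card B"
      and sz: "\<forall>X\<in>\<A>. card X = a" "\<forall>Y\<in>\<B>. card Y = b"
    \<comment> \<open>\<open>exists_map_onto\<close> needs a nonempty family. If one family is
      empty, the separating set only has to serve the other, whose members are nonempty because
      \<open>a\<close> and \<open>b\<close> are positive.\<close>
    consider "\<A> = {}" | "\<B> = {}" | "\<A> \<noteq> {}" "\<B> \<noteq> {}" by blast
    then show "separated \<A> \<B>"
    proof cases
      case 1
      then show ?thesis using sz pos by (intro separatedI[of _ "{}"]) auto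
    next
      case 2
      then show ?thesis using sz pos by (intro separatedI[of _ UNIV]) auto
    next
      case 3
      obtain g where g: "g ` A = \<A>" using exists_map_onto[OF fin(1) fin'(1) 3(1) card(1)] ..
      obtain h where h: "h ` B = \<B>" using exists_map_onto[OF fin(2) fin'(2) 3(2) card(2)] ..
      define L where "L v = (if v \<in> A then g v else h v)" for v
      have dj: "A \<inter> B = {}" using G by (simp add: complete_bipartite_on_def)
      have LA: "L ` A = \<A>" and LB: "L ` B = \<B>"
        using dj g h by (auto simp: L_def image_iff)
      have fc: "finite X" if "card X = a \<or> card X = b" for X :: "nat set"
        using that pos by (auto intro: card_ge_0_finite)
      have "ab_assignment A B a b L"
        unfolding ab_assignment_def using LA LB sz fc by blast
      then show ?thesis
        using ch exists_list_coloring_iff[OF G, of L] LA LB unfolding ab_choosable_def by metis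
    qed
  qed
next
  note fin = finite_parts[OF G]
  assume sep: "separable a (card A) b (card B)"
  show "ab_choosable G A B a b"
    unfolding ab_choosable_def exists_list_coloring_iff[OF G]
  proof (intro allI impI)
    fix L :: "'a \<Rightarrow> nat set"
    assume "ab_assignment A B a b L"
    then have sz: "\<forall>X\<in>L ` A. card X = a" "\<forall>Y\<in>L ` B. card Y = b"
      by (auto simp: ab_assignment_def)
    show "separated (L ` A) (L ` B)"
      by (rule separableD[OF sep _ _ _ _ sz]) (use fin card_image_le in auto)
  qed
qed

section \<open>Counting transversals of a disjoint family, then the positive cases\<close>

section \<open>Separable parameters\<close>

text \<open>A choice function whose range covers \<open>D\<close> has no freedom on the members that
  meet \<open>D\<close>, and there are at least \<open>card D\<close> of these. The bound is
  multiplied out to stay within the natural numbers.\<close>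

lemma card_choice_functions_covering:
  fixes \<F> :: "'c set set"
  assumes fin: "finite \<F>" and dj: "disjoint \<F>" and sz: "\<forall>X\<in>\<F>. card X = k" and "0 < k"
  shows "k ^ card D * card {f \<in> PiE \<F> (\<lambda>X. X). D \<subseteq> f ` \<F>} \<le> k ^ card \<F>"
proof (cases "{f \<in> PiE \<F> (\<lambda>X. X). D \<subseteq> f ` \<F>} = {}")
  case False
  let ?K = "{f \<in> PiE \<F> (\<lambda>X. X). D \<subseteq> f ` \<F>}"
  from False obtain g where g: "g \<in> PiE \<F> (\<lambda>X. X)" "D \<subseteq> g ` \<F>" by blast
  define \<J> where "\<J> = {X \<in> \<F>. D \<inter> X \<noteq> {}}"
  have J: "\<J> \<subseteq> \<F>" and finJ: "finite \<J>" using fin by (auto simp: \<J>_def)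
  \<comment> \<open>By disjointness, \<open>x\<close> can only have been chosen from the one member
    that contains it.\<close>
  have forced: "f X = x" if f: "f \<in> ?K" and x: "x \<in> D \<inter> X" and X: "X \<in> \<F>" for f X x
  proof -
    obtain Y where Y: "Y \<in> \<F>" "x = f Y" using f x by blast
    then have "x \<in> Y" using f by (auto simp: PiE_iff)
    then have "X = Y" using dj X Y x unfolding disjoint_def by blast
    then show ?thesis using Y by simp
  qed
  have "D \<subseteq> g ` \<J>"
  proof
    fix x assume "x \<in> D"
    then obtain X where X: "X \<in> \<F>" "x = g X" using g by blast
    then have "x \<in> X" using g by (auto simp: PiE_iff)
    then show "x \<in> g ` \<J>" using X \<open>x \<in> D\<close> by (auto simp: \<J>_def)
  qed
  then have dJ: "card D \<le> card \<J>"
    by (rule surj_card_le[OF finJ])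
  have "f X = g X" if "f \<in> ?K" "X \<in> \<J>" for f X
  proof -
    have "D \<inter> X \<noteq> {}" and X: "X \<in> \<F>" using that(2) by (simp_all add: \<J>_def)
    then obtain x where x: "x \<in> D \<inter> X" by blast
    have "g \<in> ?K" using g by simp
    from forced[OF that(1) x X] forced[OF this x X] show ?thesis by (rule trans[OF _ sym])
  qed
  \<comment> \<open>All covering functions agree with \<open>g\<close> on \<open>\<J>\<close>; only
    members outside \<open>\<J>\<close> leave \<open>k\<close> choices each.\<close>
  then have sub: "?K \<subseteq> PiE \<F> (\<lambda>X. if X \<in> \<J> then {g X} else X)"
    by (auto simp: PiE_iff extensional_def)
  have "finite X" if "X \<in> \<F>" for X using that sz \<open>0 < k\<close> by (auto intro: card_ge_0_finite)
  then have "finite (PiE \<F> (\<lambda>X. if X \<in> \<J> then {g X} else X))"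
    by (intro finite_PiE fin) auto
  then have "card ?K \<le> card (PiE \<F> (\<lambda>X. if X \<in> \<J> then {g X} else X))"
    using sub by (rule card_mono)
  also have "\<dots> = (\<Prod>X\<in>\<F>. if X \<in> \<J> then 1 else k)"
    using sz by (auto simp: card_PiE[OF fin] intro!: prod.cong)
  also have "\<dots> = k ^ card (\<F> - \<J>)"
    using J by (simp add: prod.If_cases[OF fin] Int_absorb1 Diff_eq)
  finally have "k ^ card D * card ?K \<le> k ^ card D * k ^ card (\<F> - \<J>)" by simp
  also have "\<dots> \<le> k ^ card \<J> * k ^ card (\<F> - \<J>)"
    using dJ \<open>0 < k\<close> by (simp add: power_increasing)
  also have "\<dots> = k ^ card \<F>"
    using J finJ fin card_mono[OF fin J] by (simp add: card_Diff_subset flip: power_add)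
  finally show ?thesis .
next
  case True
  then show ?thesis by (simp only: card.empty)
qed

text \<open>A union bound: a uniformly random transversal of a disjoint family of \<open>k\<close>-sets contains a
  given \<open>d\<close>-set with probability at most \<open>k\<^sup>-\<^sup>d\<close>.\<close>

lemma disjoint_transversal_avoiding:
  fixes \<F> \<D> :: "'c set set"
  assumes fin: "finite \<F>" and dj: "disjoint \<F>" and sz: "\<forall>X\<in>\<F>. card X = k" and "0 < k"
    and finD: "finite \<D>" and szD: "\<forall>D\<in>\<D>. card D = d" and few: "card \<D> < k ^ d"
  obtains T where "T \<subseteq> \<Union>\<F>" and "\<forall>X\<in>\<F>. X \<inter> T \<noteq> {}" and "\<forall>D\<in>\<D>. \<not> D \<subseteq> T"
proof -
  let ?P = "PiE \<F> (\<lambda>X. X)"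
  have "\<exists>f\<in>?P. \<forall>D\<in>\<D>. \<not> D \<subseteq> f ` \<F>"
  proof (rule ccontr)
    assume "\<not> ?thesis"
    then have eq: "?P = (\<Union>D\<in>\<D>. {f \<in> ?P. D \<subseteq> f ` \<F>})" by blast
    have "k ^ card \<F> = card ?P" using sz by (simp add: card_PiE[OF fin])
    also have "\<dots> \<le> (\<Sum>D\<in>\<D>. card {f \<in> ?P. D \<subseteq> f ` \<F>})"
      by (subst eq) (rule card_UN_le[OF finD])
    finally have "k ^ d * k ^ card \<F> \<le> (\<Sum>D\<in>\<D>. k ^ card D * card {f \<in> ?P. D \<subseteq> f ` \<F>})"
      using szD by (simp flip: sum_distrib_left)
    also have "\<dots> \<le> (\<Sum>D\<in>\<D>. k ^ card \<F>)"
      by (intro sum_mono card_choice_functions_covering fin dj sz \<open>0 < k\<close>)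
    finally have "k ^ d \<le> card \<D>" using \<open>0 < k\<close> by simp
    then show False using few by simp
  qed
  then obtain f where f: "f \<in> ?P" "\<forall>D\<in>\<D>. \<not> D \<subseteq> f ` \<F>" by blast
  have "f ` \<F> \<subseteq> \<Union>\<F>" "\<forall>X\<in>\<F>. X \<inter> f ` \<F> \<noteq> {}" using f(1) by (auto simp: PiE_iff)
  then show ?thesis using that f(2) by blast
qed

lemma separated_if_disjoint:
  assumes "finite \<A>" and "disjoint \<A>" and "\<forall>X\<in>\<A>. card X = a" and "0 < a"
    and "finite \<B>" and "\<forall>Y\<in>\<B>. card Y = b" and "card \<B> < a ^ b"
  shows "separated \<A> \<B>"
  using disjoint_transversal_avoiding[OF assms] unfolding separated_def by metis

section \<open>Separable sizes, by splitting on whether two lists share a color\<close>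

lemma not_disjointE:
  assumes "\<not> disjoint \<A>"
  obtains X Y v where "X \<in> \<A>" "Y \<in> \<A>" "X \<noteq> Y" "v \<in> X" "v \<in> Y"
  using assms unfolding disjoint_def by blast

text \<open>\<open>Z\<close> is a default that lets a possibly absent last list be treated as
  present, which saves case splits on the size of the family.\<close>

lemma subset_singleton_if_card_le_1:
  assumes "finite \<S>" and "card \<S> \<le> 1" and "P Z" and "\<forall>X\<in>\<S>. P X"
  obtains Z' where "P Z'" and "\<S> \<subseteq> {Z'}"
proof (cases "\<S> = {}")
  case True
  then show ?thesis using that assms by blast
next
  case False
  then have "card \<S> = 1" using assms by (simp add: card_gt_0_iff le_antisym Suc_leI)
  then show ?thesis using that assms(4) by (metis card_1_singletonE insertI1 subset_refl)
qed

lemma subset_doubleton_if_card_le_2: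
  assumes "finite \<S>" and "card \<S> \<le> 2" and "P Z" and "\<forall>X\<in>\<S>. P X"
  obtains Z1 Z2 where "P Z1" and "P Z2" and "\<S> \<subseteq> {Z1, Z2}"
proof (cases "\<S> = {}")
  case True
  then show ?thesis using that assms by blast
next
  case False
  then obtain Z1 where Z1: "Z1 \<in> \<S>" by blast
  then have "card (\<S> - {Z1}) \<le> 1" using assms by (simp add: card_Diff_singleton)
  then obtain Z2 where "P Z2" "\<S> - {Z1} \<subseteq> {Z2}"
    using subset_singleton_if_card_le_1[of "\<S> - {Z1}" P Z] assms by auto
  then show ?thesis using that[of Z1 Z2] Z1 assms(4) by blast
qed

lemma not_subset_if_card_less:
  "finite C \<Longrightarrow> card C < card X \<Longrightarrow> \<not> X \<subseteq> C"
  using card_mono leD by blast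

lemma card_doubleton_le: "card {x, y} \<le> 2"
  by (simp add: card_insert_if)

lemma card_3_distinct: "card {x, y, z} = 3 \<Longrightarrow> x \<noteq> y \<and> x \<noteq> z \<and> y \<noteq> z"
  by (auto simp: card_insert_if split: if_splits)

text \<open>One color of the only list is enough, as a single color contains no list of size
  \<open>b > 1\<close>.\<close>

lemma separable_one:
  assumes "0 < a" and "1 < b"
  shows "separable a 1 b n"
  unfolding separable_def
proof (intro allI impI)
  fix \<A> \<B> :: "nat set set"
  assume A: "finite \<A>" "card \<A> \<le> 1" "\<forall>X\<in>\<A>. card X = a" and B: "\<forall>Y\<in>\<B>. card Y = b"
  \<comment> \<open>A dummy list for the case that \<open>\<A>\<close> is empty.\<close>
  have "card {..<a} = a" by simp
  then obtain X where X: "card X = a" "\<A> \<subseteq> {X}"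
    using subset_singleton_if_card_le_1[of \<A> "\<lambda>X. card X = a"] A by metis
  then obtain x where "x \<in> X" using \<open>0 < a\<close> by fastforce
  then show "separated \<A> \<B>"
    using X B \<open>1 < b\<close> by (intro separatedI[of _ "{x}"] not_subset_if_card_less) auto
qed

text \<open>One color from each of the two lists gives a set too small to contain a list of size
  \<open>b > 2\<close>.\<close>

lemma separable_two:
  assumes "0 < a" and "2 < b"
  shows "separable a 2 b n"
  unfolding separable_def
proof (intro allI impI)
  fix \<A> \<B> :: "nat set set"
  assume A: "finite \<A>" "card \<A> \<le> 2" "\<forall>X\<in>\<A>. card X = a" and B: "\<forall>Y\<in>\<B>. card Y = b"
  have "card {..<a} = a" by simp
  then obtain X Y where XY: "card X = a" "card Y = a" "\<A> \<subseteq> {X, Y}"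
    using subset_doubleton_if_card_le_2[of \<A> "\<lambda>X. card X = a"] A by metis
  then obtain x y where "x \<in> X" "y \<in> Y" using \<open>0 < a\<close> by fastforce
  moreover have "card {x, y} < b" using card_doubleton_le[of x y] \<open>2 < b\<close> by simp
  ultimately show "separated \<A> \<B>"
    using XY B by (intro separatedI[of _ "{x, y}"] not_subset_if_card_less) auto
qed

text \<open>Disjoint triples fall under the union bound since \<open>8 < 3 ^ 2\<close>; otherwise a
  shared color alone meets both triples and contains no pair.\<close>

lemma separable_triples_pairs_2_8: "separable 3 2 2 8"
  unfolding separable_def
proof (intro allI impI)
  fix \<A> \<B> :: "nat set set"
  assume A: "finite \<A>" "card \<A> \<le> 2" "\<forall>X\<in>\<A>. card X = 3"
    and B: "finite \<B>" "card \<B> \<le> 8" "\<forall>Y\<in>\<B>. card Y = 2"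
  show "separated \<A> \<B>"
  proof (cases "disjoint \<A>")
    case True
    then show ?thesis using A B by (intro separated_if_disjoint[of _ 3 _ 2]) auto
  next
    case False
    then obtain X Y v where XY: "X \<in> \<A>" "Y \<in> \<A>" "X \<noteq> Y" "v \<in> X" "v \<in> Y"
      by (rule not_disjointE)
    have "\<A> = {X, Y}"
      using XY A by (intro card_seteq[symmetric]) auto
    then show ?thesis
      using XY B by (intro separatedI[of _ "{v}"] not_subset_if_card_less) auto
  qed
qed

text \<open>Disjoint pairs fall under the union bound since \<open>7 < 2 ^ 3\<close>; otherwise a
  shared color and one color of the remaining pair are too few to contain a triple.\<close>

lemma separable_pairs_triples_3_7: "separable 2 3 3 7"
  unfolding separable_def
proof (intro allI impI)
  fix \<A> \<B> :: "nat set set"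
  assume A: "finite \<A>" "card \<A> \<le> 3" "\<forall>X\<in>\<A>. card X = 2"
    and B: "finite \<B>" "card \<B> \<le> 7" "\<forall>Y\<in>\<B>. card Y = 3"
  show "separated \<A> \<B>"
  proof (cases "disjoint \<A>")
    case True
    then show ?thesis using A B by (intro separated_if_disjoint[of _ 2 _ 3]) auto
  next
    case False
    then obtain X Y v where XY: "X \<in> \<A>" "Y \<in> \<A>" "X \<noteq> Y" "v \<in> X" "v \<in> Y"
      by (rule not_disjointE)
    have "card (\<A> - {X, Y}) \<le> 1"
      using XY A by (simp add: card_Diff_subset)
    then obtain Z where Z: "card Z = 2" "\<A> - {X, Y} \<subseteq> {Z}"
      using subset_singleton_if_card_le_1[of "\<A> - {X, Y}" "\<lambda>X. card X = 2" X] A XY by auto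
    then obtain z where "z \<in> Z" by fastforce
    moreover have "card {v, z} < 3" using card_doubleton_le[of v z] by simp
    ultimately show ?thesis
      using XY Z B by (intro separatedI[of _ "{v, z}"] not_subset_if_card_less) auto
  qed
qed

text \<open>If two pairs share \<open>v\<close>, blocking the sets through \<open>v\<close> costs
  four triples, one for each choice from the other two pairs. The at most one remaining triple
  cannot block all sets that avoid \<open>v\<close>.\<close>

lemma separable_pairs_triples_4_5: "separable 2 4 3 5"
  unfolding separable_def
proof (intro allI impI)
  fix \<A> \<B> :: "nat set set"
  assume A: "finite \<A>" "card \<A> \<le> 4" "\<forall>X\<in>\<A>. card X = 2"
    and B: "finite \<B>" "card \<B> \<le> 5" "\<forall>Y\<in>\<B>. card Y = 3"
  show "separated \<A> \<B>"
  proof (cases "disjoint \<A>")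
    case True
    then show ?thesis using A B by (intro separated_if_disjoint[of _ 2 _ 3]) auto
  next
    case False
    then obtain X Y v where XY: "X \<in> \<A>" "Y \<in> \<A>" "X \<noteq> Y" "v \<in> X" "v \<in> Y"
      by (rule not_disjointE)
    obtain a b where ab: "X = {v, a}" "Y = {v, b}" "a \<noteq> v" "b \<noteq> v"
      using XY A(3) by (metis card_2_iff doubleton_eq_iff insertE singletonD)
    have "card (\<A> - {X, Y}) \<le> 2"
      using XY A by (simp add: card_Diff_subset)
    then obtain Z W where ZW: "card Z = 2" "card W = 2" "\<A> - {X, Y} \<subseteq> {Z, W}"
      using subset_doubleton_if_card_le_2[of "\<A> - {X, Y}" "\<lambda>X. card X = 2" X] A XY by auto
    then obtain c d e f where Z: "Z = {c, d}" "c \<noteq> d" and W: "W = {e, f}" "e \<noteq> f"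
      by (meson card_2_iff)
    show ?thesis
    proof (rule ccontr)
      assume nsep: "\<not> separated \<A> \<B>"
      \<comment> \<open>A set meets both \<open>X\<close> and \<open>Y\<close> as soon as it
        contains \<open>v\<close> or both partners \<open>a\<close> and \<open>b\<close>.\<close>
      have ex: "\<exists>D\<in>\<B>. D \<subseteq> T" if "v \<in> T \<or> {a, b} \<subseteq> T" "Z \<inter> T \<noteq> {}" "W \<inter> T \<noteq> {}" for T
        using that nsep ab XY ZW(3) separatedI[of \<A> T \<B>] by blast
      \<comment> \<open>A triple inside a set of at most three colors is that set, so the blocking
        list is known and its three colors are distinct.\<close>
      have tri: "{v, z, w} \<in> \<B> \<and> card {v, z, w} = 3" if zw: "z \<in> Z" "w \<in> W" for z w
      proof -
        obtain D where D: "D \<in> \<B>" "D \<subseteq> {v, z, w}" using ex[of "{v, z, w}"] zw by auto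
        moreover have "card {v, z, w} \<le> 3" by (simp add: card_insert_if)
        ultimately have "D = {v, z, w}"
          using B(3) by (intro card_seteq) auto
        then show ?thesis using D B(3) by auto
      qed
      have ne: "z \<noteq> v" "w \<noteq> v" "z \<noteq> w" if "z \<in> Z" "w \<in> W" for z w
        using card_3_distinct[OF conjunct2[OF tri[OF that]]] by simp_all
      have mem: "c \<in> Z" "d \<in> Z" "e \<in> W" "f \<in> W" using Z W by simp_all
      have dist: "v \<notin> {c, d, e, f}" "c \<noteq> e" "c \<noteq> f" "d \<noteq> e" "d \<noteq> f"
        using ne[OF mem(1,3)] ne[OF mem(1,4)] ne[OF mem(2,3)] ne[OF mem(2,4)] by simp_all
      then have distinct: "distinct [v, c, d, e, f]" using Z W by auto
      define \<Q> where "\<Q> = {{v, c, e}, {v, c, f}, {v, d, e}, {v, d, f}}"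
      have "card \<Q> = 4"
        using distinct by (simp add: \<Q>_def insert_eq_iff doubleton_eq_iff)
      moreover have "\<Q> \<subseteq> \<B>" using tri Z W by (auto simp: \<Q>_def)
      ultimately have "card (\<B> - \<Q>) \<le> 1"
        using B by (simp add: card_Diff_subset finite_subset)
      \<comment> \<open>These sets avoid \<open>v\<close>, hence are not blocked by
        \<open>\<Q>\<close>.\<close>
      moreover have "\<exists>D\<in>\<B> - \<Q>. D \<subseteq> {a, b, z, w}" if "z \<in> Z" "w \<in> W" for z w
        using ex[of "{a, b, z, w}"] that ne[OF that] ab by (auto simp: \<Q>_def)
      \<comment> \<open>Complementary choices from \<open>Z\<close> and \<open>W\<close>: one triple
        must lie in both sets, hence in \<open>{a, b}\<close>, which is too small.\<close>
      then have "\<exists>D\<in>\<B> - \<Q>. D \<subseteq> {a, b, c, e}" "\<exists>D\<in>\<B> - \<Q>. D \<subseteq> {a, b, d, f}"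
        using Z W by auto
      moreover have "finite (\<B> - \<Q>)" using B(1) by simp
      ultimately obtain D where D: "D \<in> \<B>" "D \<subseteq> {a, b, c, e}" "D \<subseteq> {a, b, d, f}"
        by (metis DiffD1 card_le_Suc0_iff_eq One_nat_def)
      then have "D \<subseteq> {a, b}" using dist Z W by auto
      then have "card D \<le> 2" using card_doubleton_le[of a b] card_mono[of "{a, b}" D] by simp
      then show False using B(3) D(1) by simp
    qed
  qed
qed

text \<open>Disjoint triples fall under the union bound since \<open>6 < 3 ^ 2\<close>. If two
  triples share \<open>v\<close>, three lists are spent on the pairs of \<open>v\<close> with the
  third triple \<open>Z\<close>, and each way the triples can overlap leaves a set avoiding
  \<open>v\<close> that the other three lists do not block.\<close>

lemma separable_triples_pairs_3_6: "separable 3 3 2 6"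
  unfolding separable_def
proof (intro allI impI)
  fix \<A> \<B> :: "nat set set"
  assume A: "finite \<A>" "card \<A> \<le> 3" "\<forall>X\<in>\<A>. card X = 3"
    and B: "finite \<B>" "card \<B> \<le> 6" "\<forall>Y\<in>\<B>. card Y = 2"
  show "separated \<A> \<B>"
  proof (cases "disjoint \<A>")
    case True
    then show ?thesis using A B by (intro separated_if_disjoint[of _ 3 _ 2]) auto
  next
    case False
    then obtain X Y v where XY: "X \<in> \<A>" "Y \<in> \<A>" "X \<noteq> Y" "v \<in> X" "v \<in> Y"
      by (rule not_disjointE)
    have "card (\<A> - {X, Y}) \<le> 1"
      using XY A by (simp add: card_Diff_subset)
    then obtain Z where Z: "card Z = 3" "\<A> - {X, Y} \<subseteq> {Z}"
      using subset_singleton_if_card_le_1[of "\<A> - {X, Y}" "\<lambda>X. card X = 3" X] A XY by auto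
    have finXYZ: "finite X" "finite Y" "finite Z"
      using A(3) XY Z by (auto intro: card_ge_0_finite)
    show ?thesis
    proof (rule ccontr)
      assume nsep: "\<not> separated \<A> \<B>"
      have ex: "\<exists>D\<in>\<B>. D \<subseteq> T" if "X \<inter> T \<noteq> {}" "Y \<inter> T \<noteq> {}" "Z \<inter> T \<noteq> {}" for T
        using that nsep Z(2) separatedI[of \<A> T \<B>] by blast
      \<comment> \<open>A pair inside a set of at most two colors equals it. Taking
        \<open>u = z\<close> shows that no single color meets all three triples.\<close>
      have pair: "{u, z} \<in> \<B> \<and> u \<noteq> z"
        if uz: "X \<inter> {u, z} \<noteq> {}" "Y \<inter> {u, z} \<noteq> {}" "Z \<inter> {u, z} \<noteq> {}" for u z
      proof -
        obtain D where D: "D \<in> \<B>" "D \<subseteq> {u, z}" using ex[OF uz] by metis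
        then have "D = {u, z}"
          using B(3) card_doubleton_le[of u z] by (intro card_seteq) auto
        then show ?thesis using D B(3) by auto
      qed
      have vZ: "v \<notin> Z" using pair[of v v] XY by auto
      define \<P> where "\<P> = (\<lambda>z. {v, z}) ` Z"
      have P: "\<P> \<subseteq> \<B>" using pair XY by (auto simp: \<P>_def)
      have "inj_on (\<lambda>z. {v, z}) Z" by (auto simp: inj_on_def doubleton_eq_iff)
      then have cP: "card \<P> = 3" unfolding \<P>_def using Z by (simp add: card_image)
      have R: "finite (\<B> - \<P>)" "card (\<B> - \<P>) \<le> 3"
        using B P cP by (simp_all add: card_Diff_subset finite_subset)
      show False
      proof (cases "X \<inter> Y = {v}")
        case False
        then obtain w where w: "w \<in> X" "w \<in> Y" "w \<noteq> v" using XY by blast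
        have wZ: "w \<notin> Z" using pair[of w w] w by auto
        define \<Q> where "\<Q> = (\<lambda>z. {w, z}) ` Z"
        have "\<Q> \<subseteq> \<B> - \<P>"
          using pair[of w] w wZ vZ by (auto simp: \<Q>_def \<P>_def doubleton_eq_iff)
        moreover have "inj_on (\<lambda>z. {w, z}) Z" by (auto simp: inj_on_def doubleton_eq_iff)
        then have "card \<Q> = 3" unfolding \<Q>_def using Z by (simp add: card_image)
        \<comment> \<open>Two common colors use up all six lists, so every list meets
          \<open>{v, w}\<close>; a transversal avoiding both is unblocked.\<close>
        ultimately have BPQ: "\<B> - \<P> = \<Q>" using R by (intro card_seteq[symmetric]) auto
        have "\<not> X \<subseteq> {v, w}" "\<not> Y \<subseteq> {v, w}"
          by (rule not_subset_if_card_less; use A(3) XY w in simp)+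
        then obtain x y where "x \<in> X - {v, w}" "y \<in> Y - {v, w}" by blast
        moreover obtain z where "z \<in> Z" using Z by fastforce
        ultimately obtain D where D: "D \<in> \<B>" "D \<subseteq> {x, y, z}" "v \<notin> D" "w \<notin> D"
          using ex[of "{x, y, z}"] vZ wZ by blast
        then have "D \<in> \<P> \<union> \<Q>" using BPQ by blast
        then show False using D by (auto simp: \<P>_def \<Q>_def)
      next
        case XYv: True
        have c2: "card (X - {v}) = 2" "card (Y - {v}) = 2" using A(3) XY finXYZ by auto
        have disjoint_case: False if "X \<inter> Z = {}" "Y \<inter> Z = {}"
        proof -
          have "2 \<le> card Z" using Z(1) by simp
          \<comment> \<open>\<open>Z\<close> is cut down to two colors to match
            \<open>X - {v}\<close> and \<open>Y - {v}\<close>; the union bound then applies to the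
            remaining lists since \<open>3 < 2 ^ 2\<close>.\<close>
          then obtain Z' where Z': "Z' \<subseteq> Z" "card Z' = 2"
            by (meson obtain_subset_with_card_n)
          have "disjoint {X - {v}, Y - {v}, Z'}"
            using that XYv Z' by (auto simp: disjoint_def)
          then obtain T where T: "T \<subseteq> \<Union>{X - {v}, Y - {v}, Z'}"
            "\<forall>S\<in>{X - {v}, Y - {v}, Z'}. S \<inter> T \<noteq> {}" "\<forall>D\<in>\<B> - \<P>. \<not> D \<subseteq> T"
            using disjoint_transversal_avoiding[of "{X - {v}, Y - {v}, Z'}" 2 "\<B> - \<P>" 2]
              R B(3) Z' c2 by auto
          have "X \<inter> T \<noteq> {}" "Y \<inter> T \<noteq> {}" "Z \<inter> T \<noteq> {}" using T(2) Z' by auto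
          then obtain D where "D \<in> \<B>" "D \<subseteq> T" using ex by blast
          then have "v \<in> T" using T(3) by (auto simp: \<P>_def)
          then show False using T(1) vZ Z'(1) by blast
        qed
        \<comment> \<open>\<open>X'\<close> and \<open>Y'\<close> are \<open>X\<close> and
          \<open>Y\<close> in either order, with \<open>X'\<close> one that meets
          \<open>Z\<close>.\<close>
        have one_case: False
          if XY'eq: "X' = X \<and> Y' = Y \<or> X' = Y \<and> Y' = X" and x1: "x1 \<in> X' \<inter> Z" for X' Y' x1
        proof -
          have XY': "X' \<inter> Y' = {v}" using XY'eq XYv by auto
          have ex': "\<exists>D\<in>\<B>. D \<subseteq> T" if "X' \<inter> T \<noteq> {}" "Y' \<inter> T \<noteq> {}" "Z \<inter> T \<noteq> {}" for T
            using ex[of T] that XY'eq by metis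
          have pair': "{u, z} \<in> \<B> \<and> u \<noteq> z"
            if "X' \<inter> {u, z} \<noteq> {}" "Y' \<inter> {u, z} \<noteq> {}" "Z \<inter> {u, z} \<noteq> {}" for u z
            using pair[of u z] that XY'eq by metis
          have c2': "card (X' - {v}) = 2" "card (Y' - {v}) = 2" using XY'eq c2 by auto
          have x1v: "x1 \<in> X' - {v}" using x1 vZ by auto
          then obtain x2 where x2: "X' - {v} = {x1, x2}" "x1 \<noteq> x2"
            using c2' by (metis card_2_iff doubleton_eq_iff insertE singletonD)
          have Pn: "D \<in> \<P> \<Longrightarrow> v \<in> D" for D by (auto simp: \<P>_def)
          show False
          proof (cases "Y' \<inter> Z = {}")
            case True
            obtain y1 y2 where y: "Y' - {v} = {y1, y2}" "y1 \<noteq> y2"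
              using c2' by (meson card_2_iff)
            have "card (Z - {x1}) = 2" using Z(1) x1 by simp
            then obtain z1 z2 where z: "Z - {x1} = {z1, z2}" "z1 \<noteq> z2"
              by (meson card_2_iff)
            have mem: "x1 \<in> X'" "x2 \<in> X'" "y1 \<in> Y'" "y2 \<in> Y'" "z1 \<in> Z" "z2 \<in> Z"
              using x2 y z by blast+
            have nv: "x1 \<noteq> v" "x2 \<noteq> v" "y1 \<noteq> v" "y2 \<noteq> v" "z1 \<noteq> v" "z2 \<noteq> v" "z1 \<noteq> x1" "z2 \<noteq> x1"
              using x2 y z vZ by blast+
            have nx: "x1 \<noteq> y1" "x1 \<noteq> y2" "x2 \<noteq> y1" "x2 \<noteq> y2"
              using mem nv XY' by blast+
            have nz: "y1 \<noteq> z1" "y1 \<noteq> z2" "y2 \<noteq> z1" "y2 \<noteq> z2"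
              using mem True by blast+
            \<comment> \<open>\<open>x1\<close> meets both \<open>X'\<close> and \<open>Z\<close>,
              so it forms a blocking pair with each \<open>y1\<close>, \<open>y2\<close>. At most
              one list is left.\<close>
            define \<Q> where "\<Q> = {{x1, y1}, {x1, y2}}"
            have "\<Q> \<subseteq> \<B> - \<P>"
              using pair'[of x1 y1] pair'[of x1 y2] mem x1 Pn nv by (auto simp: \<Q>_def)
            moreover have "card \<Q> = 2" using y nx by (simp add: \<Q>_def doubleton_eq_iff)
            ultimately have c1: "card (\<B> - \<P> - \<Q>) \<le> 1" "finite (\<B> - \<P> - \<Q>)"
              using R by (simp_all add: card_Diff_subset finite_subset)
            have rest: "\<exists>D\<in>\<B> - \<P> - \<Q>. D \<subseteq> {x2, y', z'}"
              if yz: "y' \<in> {y1, y2}" "z' \<in> {z1, z2}" for y' z'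
            proof -
              have ne: "v \<notin> {x2, y', z'}" "x1 \<notin> {x2, y', z'}" using yz nv nx x2 by auto
              obtain D where D: "D \<in> \<B>" "D \<subseteq> {x2, y', z'}"
                using ex'[of "{x2, y', z'}"] mem yz by auto
              then have "D \<notin> \<P>" "D \<notin> \<Q>" using Pn[of D] ne by (auto simp: \<Q>_def)
              then show ?thesis using D by blast
            qed
            \<comment> \<open>The single remaining list would lie in the sets of two complementary
              choices, which have only \<open>x2\<close> in common.\<close>
            obtain D where D: "\<B> - \<P> - \<Q> \<subseteq> {D}"
              using subset_singleton_if_card_le_1[OF c1(2,1), of "\<lambda>_. True"] by blast
            then have "D \<in> \<B>" "D \<subseteq> {x2, y1, z1}" "D \<subseteq> {x2, y2, z2}"
              using rest[of y1 z1] rest[of y2 z2] by blast+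
            then have "D \<subseteq> {x2}" "card D = 2" using y nz z B(3) by auto
            then show False using not_subset_if_card_less[of "{x2}" D] by simp
          next
            case False
            then obtain y1 where y1: "y1 \<in> Y' - {v}" "y1 \<in> Z" using vZ by blast
            then obtain y2 where y: "Y' - {v} = {y1, y2}" "y1 \<noteq> y2"
              using c2' by (metis card_2_iff doubleton_eq_iff insertE singletonD)
            have "\<not> Z \<subseteq> {x1, y1}"
              using Z(1) card_doubleton_le[of x1 y1] by (intro not_subset_if_card_less) auto
            then obtain z where z: "z \<in> Z" "z \<noteq> x1" "z \<noteq> y1" by blast
            have mem: "x1 \<in> X'" "x2 \<in> X'" "y1 \<in> Y'" "y2 \<in> Y'"
              using x2 y by blast+
            have nv: "x1 \<noteq> v" "x2 \<noteq> v" "y1 \<noteq> v" "y2 \<noteq> v" "z \<noteq> v"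
              using x2 y z vZ by blast+
            have nx: "x1 \<noteq> y1" "x1 \<noteq> y2" "x2 \<noteq> y1" "x2 \<noteq> y2"
              using mem nv XY' by blast+
            \<comment> \<open>Each of these pairs uses \<open>x1\<close> or \<open>y1\<close> to
              meet \<open>Z\<close> and so must be a list. Together with \<open>\<P>\<close> they
              exhaust \<open>\<B>\<close>.\<close>
            define \<Q> where "\<Q> = {{x1, y1}, {x1, y2}, {x2, y1}}"
            have "\<Q> \<subseteq> \<B> - \<P>"
              using pair'[of x1 y1] pair'[of x1 y2] pair'[of x2 y1] mem x1 y1 Pn nv
              by (auto simp: \<Q>_def)
            moreover have "card \<Q> = 3" using x2 y nx by (simp add: \<Q>_def doubleton_eq_iff)
            ultimately have BPQ: "\<B> - \<P> = \<Q>" using R by (intro card_seteq[symmetric]) auto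
            \<comment> \<open>This transversal avoids \<open>v\<close>, \<open>x1\<close> and
              \<open>y1\<close>, while every list contains one of them.\<close>
            obtain D where D: "D \<in> \<B>" "D \<subseteq> {x2, y2, z}"
              using ex'[of "{x2, y2, z}"] mem z by auto
            have "v \<notin> D" "x1 \<notin> D" "y1 \<notin> D" using D(2) nv nx x2 y z by blast+
            then have "D \<notin> \<P>" "D \<notin> \<Q>" using Pn[of D] by (auto simp: \<Q>_def)
            then show False using D(1) BPQ by blast
          qed
        qed
        show False
          using disjoint_case one_case[of X Y] one_case[of Y X] XYv by blast
      qed
    qed
  qed
qed

section \<open>Families that block every set of colors\<close>

section \<open>Inseparable parameters\<close>

text \<open>The pairs are all transversals of two disjoint triples.\<close>

lemma not_separable_triples_pairs_2_9: "\<not> separable 3 2 2 9"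
proof (rule not_separableI)
  let ?A = "{{0, 1, 2}, {3, 4, 5}} :: nat set set"
    and ?B = "{{0, 3}, {0, 4}, {0, 5}, {1, 3}, {1, 4}, {1, 5}, {2, 3}, {2, 4}, {2, 5}}"
  show "\<not> separated ?A ?B"
    \<comment> \<open>What remains is a propositional formula about which of the colors 0 to 5 lie
      in the set.\<close>
    by (rule not_separatedI) (simp, sat)
qed (simp_all add: card_insert_le_m1)

text \<open>A set through the shared color 0 contains a pair of 0 with a color of the third triple.
  A set avoiding 0 contains one of 1, 2 and one of 3, 4.\<close>

lemma not_separable_triples_pairs_3_7: "\<not> separable 3 3 2 7"
proof (rule not_separableI)
  let ?A = "{{0, 1, 2}, {0, 3, 4}, {5, 6, 7}} :: nat set set"
    and ?B = "{{0, 5}, {0, 6}, {0, 7}, {1, 3}, {1, 4}, {2, 3}, {2, 4}}"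
  show "\<not> separated ?A ?B"
    by (rule not_separatedI) (simp, sat)
qed (simp_all add: card_insert_le_m1)

text \<open>The pairs form a 4-cycle on 0, 1, 2, 3 and a separate edge on 4, 5. A set containing no
  pair misses all of \<open>{0, 2}\<close> or all of \<open>{1, 3}\<close>, and also misses 4 or 5;
  the triples are exactly these combinations.\<close>

lemma not_separable_triples_pairs_4_5: "\<not> separable 3 4 2 5"
proof (rule not_separableI)
  let ?A = "{{0, 2, 4}, {0, 2, 5}, {1, 3, 4}, {1, 3, 5}} :: nat set set"
    and ?B = "{{0, 1}, {1, 2}, {2, 3}, {3, 0}, {4, 5}}"
  show "\<not> separated ?A ?B"
    by (rule not_separatedI) (simp, sat)
qed (simp_all add: card_insert_le_m1)

text \<open>The triples are all transversals of three disjoint pairs.\<close>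

lemma not_separable_pairs_triples_3_8: "\<not> separable 2 3 3 8"
proof (rule not_separableI)
  let ?A = "{{0, 1}, {2, 3}, {4, 5}} :: nat set set"
    and ?B = "{{0, 2, 4}, {0, 2, 5}, {0, 3, 4}, {0, 3, 5},
      {1, 2, 4}, {1, 2, 5}, {1, 3, 4}, {1, 3, 5}}"
  show "\<not> separated ?A ?B"
    by (rule not_separatedI) (simp, sat)
qed (simp_all add: card_insert_le_m1)

text \<open>A set through the shared color 0 is blocked by one of four triples. A set avoiding 0
  contains 1, 2 and one of 3, 4.\<close>

lemma not_separable_pairs_triples_4_6: "\<not> separable 2 4 3 6"
proof (rule not_separableI)
  let ?A = "{{0, 1}, {0, 2}, {3, 4}, {5, 6}} :: nat set set"
    and ?B = "{{0, 3, 5}, {0, 3, 6}, {0, 4, 5}, {0, 4, 6}, {1, 2, 3}, {1, 2, 4}}"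
  show "\<not> separated ?A ?B"
    by (rule not_separatedI) (simp, sat)
qed (simp_all add: card_insert_le_m1)

section \<open>Assembly of the two characterizations\<close>

lemma separable_triples_pairs_iff:
  assumes "1 \<le> m" and "m \<le> n"
  shows "separable 3 m 2 n \<longleftrightarrow>
    m = 1 \<or> (m = 2 \<and> n \<le> 8) \<or> (m = 3 \<and> n \<le> 6) \<or> (m = 4 \<and> n = 4)"
proof
  assume sep: "separable 3 m 2 n"
  \<comment> \<open>The last exclusion covers every \<open>m \<ge> 5\<close>, because then
    \<open>n \<ge> 5\<close> as well.\<close>
  have "\<not> (2 \<le> m \<and> 9 \<le> n)" "\<not> (3 \<le> m \<and> 7 \<le> n)" "\<not> (4 \<le> m \<and> 5 \<le> n)"
    using separable_mono[OF sep] not_separable_triples_pairs_2_9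
      not_separable_triples_pairs_3_7 not_separable_triples_pairs_4_5 by blast+
  then show "m = 1 \<or> (m = 2 \<and> n \<le> 8) \<or> (m = 3 \<and> n \<le> 6) \<or> (m = 4 \<and> n = 4)"
    using assms by linarith
next
  assume "m = 1 \<or> (m = 2 \<and> n \<le> 8) \<or> (m = 3 \<and> n \<le> 6) \<or> (m = 4 \<and> n = 4)"
  \<comment> \<open>Four pairs against five triples, read from the other side, gives the case
    \<open>m = n = 4\<close> by monotonicity.\<close>
  moreover have "separable 3 5 2 4"
    using separable_pairs_triples_4_5 separable_commute by blast
  ultimately show "separable 3 m 2 n"
    using separable_one[of 3 2 n] separable_mono[OF separable_triples_pairs_2_8, of m n]
      separable_mono[OF separable_triples_pairs_3_6, of m n] separable_mono[of 3 5 2 4 m n]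
    by auto
qed

lemma separable_pairs_triples_iff:
  assumes "1 \<le> m" and "m \<le> n"
  shows "separable 2 m 3 n \<longleftrightarrow> m \<in> {1, 2} \<or> (m = 3 \<and> n \<le> 7) \<or> (m = 4 \<and> n \<le> 5)"
proof
  assume sep: "separable 2 m 3 n"
  \<comment> \<open>The example of four triples and five pairs, with sides exchanged, rules out
    every \<open>m \<ge> 5\<close>.\<close>
  have "\<not> separable 2 5 3 4"
    using not_separable_triples_pairs_4_5 separable_commute by blast
  then have "\<not> (3 \<le> m \<and> 8 \<le> n)" "\<not> (4 \<le> m \<and> 6 \<le> n)" "\<not> (5 \<le> m \<and> 4 \<le> n)"
    using separable_mono[OF sep] not_separable_pairs_triples_3_8
      not_separable_pairs_triples_4_6 by blast+
  then show "m \<in> {1, 2} \<or> (m = 3 \<and> n \<le> 7) \<or> (m = 4 \<and> n \<le> 5)"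
    using assms by simp linarith
next
  assume "m \<in> {1, 2} \<or> (m = 3 \<and> n \<le> 7) \<or> (m = 4 \<and> n \<le> 5)"
  then show "separable 2 m 3 n"
    using separable_one[of 2 3 n] separable_two[of 2 3 n]
      separable_mono[OF separable_pairs_triples_3_7, of m n]
      separable_mono[OF separable_pairs_triples_4_5, of m n]
    by auto
qed

theorem theorem9:
  fixes G :: "('v, 'e) pre_digraph" and A B :: "'v set" and m n :: nat
  assumes "1 \<le> m" and "m \<le> n"
    and "complete_bipartite_on G A B" and "card A = m" and "card B = n"
  shows "(ab_choosable G A B 3 2 \<longleftrightarrow>
            m = 1 \<or> (m = 2 \<and> n \<le> 8) \<or> (m = 3 \<and> n \<le> 6) \<or> (m = 4 \<and> n = 4)) \<and>
         (ab_choosable G A B 2 3 \<longleftrightarrow>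
            m \<in> {1, 2} \<or> (m = 3 \<and> n \<le> 7) \<or> (m = 4 \<and> n \<le> 5))"
proof -
  have "A \<noteq> {}" "B \<noteq> {}" using assms by auto
  then show ?thesis
    using ab_choosable_iff_separable[OF assms(3)] separable_triples_pairs_iff[OF assms(1,2)]
      separable_pairs_triples_iff[OF assms(1,2)] assms(4,5) by simp
qed

end
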